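(* The errors in general summation of real numbers $x_1,\ldots,x_n$ equal $$e_k=\hat{s}_k-s_k=\sum_{j\preceq k}(s_j+f_j)\,\delta_j,\qquad 2\le k\le n,$$ and similarly $$f_k=\sum_{j\prec k}(s_j+f_j)\,\delta_j,\qquad 2\le k\le n,$$ where $f_k$ is the sum of the errors of the two children of $s_k$ and the sums are over $j\in\{2,\ldots,n\}$.
   Context: General summation of real numbers $x_1,\ldots,x_n$ ($n\ge 2$): start with the multiset $\mathcal{S}=\{x_1,\ldots,x_n\}$; for $k=2,\ldots,n$ remove two elements $x,y$ from $\mathcal{S}$, set $s_k=x+y$, and add $s_k$ to $\mathcal{S}$; the output is $s_n=\sum_{i=1}^n x_i$. The order of summation (which two elements are removed at each step) is fixed in advance. The computational tree is the binary tree with $2n-1$ vertices whose leaves are the inputs $x_1,\ldots,x_n$, whose internal vertices are the exact partial sums $s_2,\ldots,s_n$ (root $s_n$), where the two children of $s_k$ are the two elements $x,y$ with $s_k=x+y$. For $j,k\in\{2,\ldots,n\}$ write $j\prec k$ if the vertex $s_j$ is a (proper) descendant of the vertex $s_k$, and $j\preceq k$ if $j\prec k$ or $j=k$. Floating point model (unit roundoff $0<u<1$, no overflow or underflow): inputs are stored exactly, and if $\hat{x},\hat{y}$ are the computed values of the children $x,y$ of $s_k$ (a leaf has computed value equal to its exact value), the computed value of $s_k$ is $\hat{s}_k=(\hat{x}+\hat{y})(1+\delta_k)$ with $|\delta_k|\le u$, $2\le k\le n$. With $e_x=\hat{x}-x$ and $e_y=\hat{y}-y$ the errors of the children of $s_k$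 (zero for leaves), $f_k\equiv e_x+e_y$. Empty sums equal $0$. *)

theory Defs
  imports Complex_Main
begin

text \<open>
  Vertices of the computational tree: \<open>Leaf i\<close> is the input \<open>x\<^sub>i\<close> and \<open>Node k\<close> is the partial
  sum \<open>s\<^sub>k\<close>. Working with vertices rather than with their real values keeps apart inputs or
  partial sums that happen to be equal (the multiset of the algorithm), and expresses that the
  order of summation is fixed in advance, independently of the data.
\<close>

datatype vertex = Leaf nat | Node nat

text \<open>
  A summation order is given by functions \<open>l\<close> and \<open>r\<close>: step \<open>k\<close> removes \<open>l k\<close> and \<open>r k\<close> and
  inserts \<open>Node k\<close>. The first step has number 2, so \<open>available n l r m\<close>, the content of the
  multiset after \<open>m\<close> additions, is what step \<open>m + 2\<close> selects from.
\<close>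

primrec available ::
    "nat \<Rightarrow> (nat \<Rightarrow> vertex) \<Rightarrow> (nat \<Rightarrow> vertex) \<Rightarrow> nat \<Rightarrow> vertex set" where
  "available n l r 0 = Leaf ` {1..n}"
| "available n l r (Suc m) =
     insert (Node (m + 2)) (available n l r m - {l (m + 2), r (m + 2)})"

definition summation_order :: "nat \<Rightarrow> (nat \<Rightarrow> vertex) \<Rightarrow> (nat \<Rightarrow> vertex) \<Rightarrow> bool" where
  "summation_order n l r \<longleftrightarrow>
     (\<forall>k\<in>{2..n}. l k \<in> available n l r (k - 2) \<and> r k \<in> available n l r (k - 2) \<and> l k \<noteq> r k)"

definition child_rel ::
    "nat \<Rightarrow> (nat \<Rightarrow> vertex) \<Rightarrow> (nat \<Rightarrow> vertex) \<Rightarrow> (vertex \<times> vertex) set" where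
  "child_rel n l r = {(v, Node k) | v k. k \<in> {2..n} \<and> (v = l k \<or> v = r k)}"

definition proper_desc ::
    "nat \<Rightarrow> (nat \<Rightarrow> vertex) \<Rightarrow> (nat \<Rightarrow> vertex) \<Rightarrow> nat \<Rightarrow> nat \<Rightarrow> bool" where
  "proper_desc n l r j k \<longleftrightarrow> (Node j, Node k) \<in> (child_rel n l r)\<^sup>+"

definition desc_eq ::
    "nat \<Rightarrow> (nat \<Rightarrow> vertex) \<Rightarrow> (nat \<Rightarrow> vertex) \<Rightarrow> nat \<Rightarrow> nat \<Rightarrow> bool" where
  "desc_eq n l r j k \<longleftrightarrow> proper_desc n l r j k \<or> j = k"

text \<open>
  The value at a vertex, for inputs \<open>x\<close> and (exact or computed) partial sums \<open>t\<close>; the computed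
  value of a leaf is its exact value.
\<close>

primrec val :: "(nat \<Rightarrow> real) \<Rightarrow> (nat \<Rightarrow> real) \<Rightarrow> vertex \<Rightarrow> real" where
  "val x t (Leaf i) = x i"
| "val x t (Node k) = t k"

definition exact_sums ::
    "nat \<Rightarrow> (nat \<Rightarrow> vertex) \<Rightarrow> (nat \<Rightarrow> vertex) \<Rightarrow> (nat \<Rightarrow> real) \<Rightarrow> (nat \<Rightarrow> real) \<Rightarrow> bool" where
  "exact_sums n l r x s \<longleftrightarrow> (\<forall>k\<in>{2..n}. s k = val x s (l k) + val x s (r k))"

definition computed_sums ::
    "nat \<Rightarrow> (nat \<Rightarrow> vertex) \<Rightarrow> (nat \<Rightarrow> vertex) \<Rightarrow> real \<Rightarrow> (nat \<Rightarrow> real) \<Rightarrow> (nat \<Rightarrow> real) \<Rightarrow>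
      (nat \<Rightarrow> real) \<Rightarrow> bool" where
  "computed_sums n l r u \<delta> x s' \<longleftrightarrow>
     (\<forall>k\<in>{2..n}. s' k = (val x s' (l k) + val x s' (r k)) * (1 + \<delta> k) \<and> \<bar>\<delta> k\<bar> \<le> u)"

definition vertex_error ::
    "(nat \<Rightarrow> real) \<Rightarrow> (nat \<Rightarrow> real) \<Rightarrow> (nat \<Rightarrow> real) \<Rightarrow> vertex \<Rightarrow> real" where
  "vertex_error x s s' v = val x s' v - val x s v"

definition child_errors ::
    "(nat \<Rightarrow> vertex) \<Rightarrow> (nat \<Rightarrow> vertex) \<Rightarrow> (nat \<Rightarrow> real) \<Rightarrow> (nat \<Rightarrow> real) \<Rightarrow> (nat \<Rightarrow> real) \<Rightarrow>
      nat \<Rightarrow> real" where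
  "child_errors l r x s s' k = vertex_error x s s' (l k) + vertex_error x s s' (r k)"

end

theory Submission
  imports Defs
begin

text \<open>
  The computed sum at \<open>k\<close> is the exact sum of the exact children, plus the error \<open>f k\<close> inherited
  from the computed children, multiplied by \<open>1 + \<delta> k\<close>. Hence
  \<open>e k = f k + (s k + f k) * \<delta> k\<close>: every addition passes on the errors of its two children
  unchanged and contributes exactly one new term. Unrolling this recursion from the root \<open>s k\<close>
  down to the leaves, which carry no error, collects one term for each partial sum met on the way.

  That this yields a sum over the set of descendants, each counted once, is where the tree structure
  enters: the subtrees of the two children of a vertex must be disjoint
  (\<open>child_subtrees_disjoint\<close>). Two facts about the order of summation give this. A vertex is
  removed from the multiset when it is used and never returns, so it has at most one parent
  (\<open>single_valued_child_rel\<close>); consequently the ancestors of a vertex form a chain. Moreover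
  step numbers increase strictly from child to parent (\<open>step_less_if_descendant\<close>), so the
  child relation has no cycles.
\<close>

section \<open>The computational tree\<close>

text \<open>
  The time at which a vertex enters the multiset. Input vertices get \<open>0\<close>, which is below the number
  of the first step, 2.
\<close>

primrec step_of :: "vertex \<Rightarrow> nat" where
  "step_of (Leaf i) = 0"
| "step_of (Node k) = k"

definition subtree ::
    "nat \<Rightarrow> (nat \<Rightarrow> vertex) \<Rightarrow> (nat \<Rightarrow> vertex) \<Rightarrow> vertex \<Rightarrow> nat set" where
  "subtree n l r v = {j \<in> {2..n}. (Node j, v) \<in> (child_rel n l r)\<^sup>*}"

lemma finite_subtree: "finite (subtree n l r v)"
  by (simp add: subtree_def)

lemma available_step_le:
  "v \<in> available n l r m \<Longrightarrow> step_of v \<le> Suc m"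
  by (induction m) auto

lemma available_Node_ge:
  "Node j \<in> available n l r m \<Longrightarrow> 2 \<le> j"
  by (induction m) auto

text \<open>
  Every later step inserts a vertex with a larger step number, so a vertex that could have been
  present after \<open>m\<close> additions but is absent then stays absent.
\<close>

lemma not_available_mono:
  assumes "m \<le> m'" "v \<notin> available n l r m" "step_of v \<le> Suc m"
  shows "v \<notin> available n l r m'"
  using assms by (induction m' rule: dec_induct) auto

lemma child_relE:
  assumes "(v, w) \<in> child_rel n l r" "summation_order n l r"
  obtains k where "w = Node k" "k \<in> {2..n}" "v = l k \<or> v = r k"
    "v \<in> available n l r (k - 2)"
  using assms unfolding child_rel_def summation_order_def by blast

lemma child_step_less:
  assumes "(v, w) \<in> child_rel n l r" "summation_order n l r"
  shows "step_of v < step_of w"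
  using assms
proof (rule child_relE)
  fix k assume "w = Node k" "k \<in> {2..n}" "v \<in> available n l r (k - 2)"
  then show ?thesis using available_step_le[of v n l r "k - 2"] by auto
qed

lemma step_less_if_descendant:
  assumes "(v, w) \<in> (child_rel n l r)\<^sup>+" "summation_order n l r"
  shows "step_of v < step_of w"
  using assms(1)
proof (induction rule: trancl_induct)
  case (base y)
  then show ?case by (rule child_step_less[OF _ assms(2)])
next
  case (step y z)
  then show ?case using child_step_less[OF step.hyps(2) assms(2)] by simp
qed

lemma child_not_reused:
  assumes "summation_order n l r" "k \<in> {2..n}" "v = l k \<or> v = r k" "k < k'"
  shows "v \<notin> available n l r (k' - 2)"
proof -
  obtain m where k: "k = m + 2"
    using assms(2) by (metis atLeastAtMost_iff le_add_diff_inverse2)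
  have "v \<in> available n l r (k - 2)"
    using assms unfolding summation_order_def by blast
  then have step: "step_of v \<le> Suc m"
    using available_step_le k by fastforce
  then have "v \<noteq> Node k"
    using k by auto
  then have "v \<notin> available n l r (Suc m)"
    using assms(3) k by auto
  moreover have "Suc m \<le> k' - 2"
    using assms(4) k by linarith
  moreover have "step_of v \<le> Suc (Suc m)"
    using step by (rule le_SucI)
  ultimately show ?thesis
    by (metis not_available_mono)
qed

lemma single_valued_child_rel:
  assumes "summation_order n l r"
  shows "single_valued (child_rel n l r)"
proof (rule single_valuedI)
  fix v w w'
  assume vw: "(v, w) \<in> child_rel n l r" and vw': "(v, w') \<in> child_rel n l r"
  obtain k where k: "w = Node k" "k \<in> {2..n}" "v = l k \<or> v = r k"
      "v \<in> available n l r (k - 2)"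
    using vw assms by (rule child_relE)
  obtain k' where k': "w' = Node k'" "k' \<in> {2..n}" "v = l k' \<or> v = r k'"
      "v \<in> available n l r (k' - 2)"
    using vw' assms by (rule child_relE)
  have "\<not> k < k'"
    using child_not_reused[OF assms k(2,3)] k'(4) by blast
  moreover have "\<not> k' < k"
    using child_not_reused[OF assms k'(2,3)] k(4) by blast
  ultimately show "w = w'" using k(1) k'(1) by simp
qed

text \<open>
  A sibling \<open>w\<close> that is an ancestor of \<open>v\<close> would have to be above the only parent of \<open>v\<close>, which
  is also the parent of \<open>w\<close>: a cycle.
\<close>

lemma sibling_not_ancestor:
  assumes ord: "summation_order n l r"
    and v: "(v, p) \<in> child_rel n l r" and w: "(w, p) \<in> child_rel n l r" and "v \<noteq> w"
  shows "(v, w) \<notin> (child_rel n l r)\<^sup>*"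
proof
  assume "(v, w) \<in> (child_rel n l r)\<^sup>*"
  then obtain q where "(v, q) \<in> child_rel n l r" and qw: "(q, w) \<in> (child_rel n l r)\<^sup>*"
    using \<open>v \<noteq> w\<close> by (meson converse_rtranclE)
  then have "q = p"
    using single_valued_child_rel[OF ord] v by (meson single_valuedD)
  then have "(p, p) \<in> (child_rel n l r)\<^sup>+"
    using qw w by (meson rtrancl_into_trancl1)
  then show False using step_less_if_descendant[OF _ ord] by blast
qed

text \<open>
  A common descendant of both children would have the two children in its chain of ancestors, so
  one child would be above the other.
\<close>

lemma child_subtrees_disjoint:
  assumes ord: "summation_order n l r" and k: "k \<in> {2..n}"
  shows "subtree n l r (l k) \<inter> subtree n l r (r k) = {}"
proof (rule ccontr)
  assume "\<not> ?thesis"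
  then obtain j where "(Node j, l k) \<in> (child_rel n l r)\<^sup>*" "(Node j, r k) \<in> (child_rel n l r)\<^sup>*"
    by (auto simp: subtree_def)
  then have "(l k, r k) \<in> (child_rel n l r)\<^sup>* \<or> (r k, l k) \<in> (child_rel n l r)\<^sup>*"
    by (rule single_valued_confluent[OF single_valued_child_rel[OF ord]])
  moreover have "(l k, Node k) \<in> child_rel n l r" "(r k, Node k) \<in> child_rel n l r"
    using k by (auto simp: child_rel_def)
  moreover have "l k \<noteq> r k"
    using ord k by (auto simp: summation_order_def)
  ultimately show False
    using sibling_not_ancestor[OF ord] by metis
qed

lemma subtree_Leaf: "subtree n l r (Leaf i) = {}"
proof -
  have "(Node j, Leaf i) \<notin> (child_rel n l r)\<^sup>*" for j
  proof
    assume "(Node j, Leaf i) \<in> (child_rel n l r)\<^sup>*"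
    then show False by (rule rtranclE) (simp_all add: child_rel_def)
  qed
  then show ?thesis by (simp add: subtree_def)
qed

lemma proper_desc_iff:
  assumes "k \<in> {2..n}"
  shows "proper_desc n l r j k \<longleftrightarrow>
    (Node j, l k) \<in> (child_rel n l r)\<^sup>* \<or> (Node j, r k) \<in> (child_rel n l r)\<^sup>*"
proof -
  have "(v, Node k) \<in> child_rel n l r \<longleftrightarrow> v = l k \<or> v = r k" for v
    using assms by (auto simp: child_rel_def)
  then show ?thesis
    unfolding proper_desc_def trancl_unfold_right relcomp_unfold by auto
qed

lemma proper_descendants_eq:
  assumes "k \<in> {2..n}"
  shows "{j \<in> {2..n}. proper_desc n l r j k} = subtree n l r (l k) \<union> subtree n l r (r k)"
  using assms by (auto simp: subtree_def proper_desc_iff)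

lemma not_proper_desc_self:
  assumes "summation_order n l r"
  shows "\<not> proper_desc n l r k k"
  using step_less_if_descendant[OF _ assms] unfolding proper_desc_def by blast

lemma descendants_eq_insert:
  assumes "k \<in> {2..n}"
  shows "{j \<in> {2..n}. desc_eq n l r j k} = insert k {j \<in> {2..n}. proper_desc n l r j k}"
  using assms by (auto simp: desc_eq_def)

lemma subtree_Node: "subtree n l r (Node k) = {j \<in> {2..n}. desc_eq n l r j k}"
  by (auto simp: subtree_def desc_eq_def proper_desc_def rtrancl_eq_or_trancl)

lemma sum_proper_descendants:
  fixes g :: "nat \<Rightarrow> 'a::comm_monoid_add"
  assumes "summation_order n l r" "k \<in> {2..n}"
  shows "(\<Sum>j\<in>{j \<in> {2..n}. proper_desc n l r j k}. g j) =
    (\<Sum>j\<in>subtree n l r (l k). g j) + (\<Sum>j\<in>subtree n l r (r k). g j)"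
  unfolding proper_descendants_eq[OF assms(2)]
  by (rule sum.union_disjoint[OF finite_subtree finite_subtree child_subtrees_disjoint[OF assms]])

lemma sum_descendants:
  fixes g :: "nat \<Rightarrow> 'a::comm_monoid_add"
  assumes "summation_order n l r" "k \<in> {2..n}"
  shows "(\<Sum>j\<in>{j \<in> {2..n}. desc_eq n l r j k}. g j) =
    g k + (\<Sum>j\<in>{j \<in> {2..n}. proper_desc n l r j k}. g j)"
  unfolding descendants_eq_insert[OF assms(2)]
  using not_proper_desc_self[OF assms(1)] by simp

section \<open>Propagation of errors\<close>

lemma error_recursion:
  assumes "exact_sums n l r x s" "computed_sums n l r u \<delta> x s'" "k \<in> {2..n}"
  shows "s' k - s k = child_errors l r x s s' k + (s k + child_errors l r x s s' k) * \<delta> k"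
proof -
  have "s k = val x s (l k) + val x s (r k)"
    using assms by (simp add: exact_sums_def)
  moreover have "s' k = (val x s' (l k) + val x s' (r k)) * (1 + \<delta> k)"
    using assms by (simp add: computed_sums_def)
  ultimately show ?thesis
    by (simp add: child_errors_def vertex_error_def algebra_simps)
qed

text \<open>
  Leaves and partial sums are treated together here because a child of a partial sum can be either.
  The induction follows the step numbers, along which the children precede their parent.
\<close>

lemma vertex_error_eq_sum_subtree:
  assumes ord: "summation_order n l r"
    and ex: "exact_sums n l r x s" and comp: "computed_sums n l r u \<delta> x s'"
    and "v \<in> range Leaf \<union> Node ` {2..n}"
  shows "vertex_error x s s' v =
    (\<Sum>j\<in>subtree n l r v. (s j + child_errors l r x s s' j) * \<delta> j)"
  using assms(4)
proof (induction v rule: measure_induct_rule[where f = step_of])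
  case (less v)
  show ?case
  proof (cases v)
    case (Leaf i)
    then show ?thesis by (simp add: vertex_error_def subtree_Leaf)
  next
    case (Node k)
    let ?g = "\<lambda>j. (s j + child_errors l r x s s' j) * \<delta> j"
    have k: "k \<in> {2..n}" using less.prems Node by auto
    have child: "vertex_error x s s' c = (\<Sum>j\<in>subtree n l r c. ?g j)" if "c = l k \<or> c = r k" for c
    proof (rule less.IH)
      have edge: "(c, Node k) \<in> child_rel n l r"
        using that k by (auto simp: child_rel_def)
      show lt: "step_of c < step_of v"
        using child_step_less[OF edge ord] Node by simp
      have "c \<in> available n l r (k - 2)"
        using that ord k by (auto simp: summation_order_def)
      then show "c \<in> range Leaf \<union> Node ` {2..n}"
        using available_Node_ge lt k Node by (cases c) auto
    qed
    have "child_errors l r x s s' k =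
        (\<Sum>j\<in>subtree n l r (l k). ?g j) + (\<Sum>j\<in>subtree n l r (r k). ?g j)"
      by (simp add: child_errors_def child)
    then have inherited:
        "child_errors l r x s s' k = (\<Sum>j\<in>{j \<in> {2..n}. proper_desc n l r j k}. ?g j)"
      by (rule trans[OF _ sum_proper_descendants[OF ord k, symmetric]])
    have "vertex_error x s s' v = child_errors l r x s s' k + ?g k"
      using error_recursion[OF ex comp k] Node by (simp add: vertex_error_def)
    moreover have "(\<Sum>j\<in>subtree n l r v. ?g j) =
        ?g k + (\<Sum>j\<in>{j \<in> {2..n}. proper_desc n l r j k}. ?g j)"
      unfolding Node subtree_Node by (rule sum_descendants[OF ord k])
    ultimately show ?thesis
      using inherited by linarith
  qed
qed

theorem lemma2p3:
  fixes n :: nat and l r :: "nat \<Rightarrow> vertex"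
    and x s s' \<delta> e f :: "nat \<Rightarrow> real" and u :: real
  assumes "n \<ge> 2"
    and "summation_order n l r"
    and "exact_sums n l r x s"
    and "0 < u" and "u < 1"
    and "computed_sums n l r u \<delta> x s'"
    and "\<And>k. k \<in> {2..n} \<Longrightarrow> e k = s' k - s k"
    and "\<And>k. k \<in> {2..n} \<Longrightarrow> f k = child_errors l r x s s' k"
  shows "\<forall>k\<in>{2..n}.
      e k = (\<Sum>j\<in>{j\<in>{2..n}. desc_eq n l r j k}. (s j + f j) * \<delta> j) \<and>
      f k = (\<Sum>j\<in>{j\<in>{2..n}. proper_desc n l r j k}. (s j + f j) * \<delta> j)"
proof
  fix k assume k: "k \<in> {2..n}"
  let ?P = "{j \<in> {2..n}. proper_desc n l r j k}"
  let ?D = "{j \<in> {2..n}. desc_eq n l r j k}"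
  let ?g = "\<lambda>j. (s j + child_errors l r x s s' j) * \<delta> j"
  have f_sum: "(\<Sum>j\<in>A. (s j + f j) * \<delta> j) = (\<Sum>j\<in>A. ?g j)" if "A \<subseteq> {2..n}" for A
    using that assms(8) by (intro sum.cong) auto
  have "e k = vertex_error x s s' (Node k)"
    using assms(7)[OF k] by (simp add: vertex_error_def)
  also have "\<dots> = (\<Sum>j\<in>?D. ?g j)"
    using vertex_error_eq_sum_subtree[OF assms(2,3,6), of "Node k"] k by (simp add: subtree_Node)
  finally have e: "e k = (\<Sum>j\<in>?D. ?g j)" .
  \<comment> \<open>The root's own term is exactly what separates \<open>e k\<close> from \<open>f k\<close>.\<close>
  have "e k = f k + ?g k"
    using error_recursion[OF assms(3,6) k] assms(7,8)[OF k] by simp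
  then have f: "f k = (\<Sum>j\<in>?P. ?g j)"
    unfolding e sum_descendants[OF assms(2) k] by linarith
  show "e k = (\<Sum>j\<in>?D. (s j + f j) * \<delta> j) \<and> f k = (\<Sum>j\<in>?P. (s j + f j) * \<delta> j)"
  proof
    show "e k = (\<Sum>j\<in>?D. (s j + f j) * \<delta> j)"
      by (rule trans[OF e f_sum[OF Collect_restrict, symmetric]])
    show "f k = (\<Sum>j\<in>?P. (s j + f j) * \<delta> j)"
      by (rule trans[OF f f_sum[OF Collect_restrict, symmetric]])
  qed
qed

end
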